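(* Let $A\in\mathbb{R}^{n\times n}$ be invertible and symmetric, with distinct eigenvalues $a_1,\dots,a_p$ and, for each $i$, an orthonormal basis $u_{i,1},\dots,u_{i,n_i}$ of the eigenspace of $a_i$. Consider the nonlinear eigenvalue problem $\Pi(u)u=\lambda u$. Consider vectors of the form $$(\ast)\qquad u^*=\sum_{s=1}^{n_{i_1}}c_{i_1,s}u_{i_1,s}+\sum_{r=1}^{n_{i_2}}c_{i_2,r}u_{i_2,r},\qquad i_1\neq i_2,\ i_1,i_2\in\{1,\dots,p\},$$ with real coefficients such that at least one of the $c_{i_1,s}$ is nonzero and at least one of the $c_{i_2,r}$ is nonzero. (a) If $A$ is definite, then the eigenvectors associated with nonzero eigenvalues are exactly the vectors of the form $(\ast)$. Moreover, all these eigenvalues are less than one, and the eigenvalue of $u^*$ is $$\lambda_{i_1i_2}=\frac{(a_{i_2}-a_{i_1})^2}{a_{i_1}^2+\epsilon^2a_{i_2}^2}\cdot\frac{1}{1+\frac{1}{\epsilon^2}},\qquad \epsilon^2=\frac{\sum_{r=1}^{n_{i_2}}c_{i_2,r}^2}{\sum_{s=1}^{n_{i_1}}c_{i_1,s}^2}.$$ (b) If $A$ is indefinite, then every eigenvector associated with an eigenvalue different from one is of the form $(\ast)$, and the eigenvectors associated with eigenvalue one are exactly the nonzero vectors $u^*$ with $\langle Au^*,u^*\rangle=0$.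
   Context: $\langle\cdot,\cdot\rangle$ is the Euclidean inner product. For $0\neq v\in\mathbb{R}^n$, $\alpha(v)=\frac{\langle v,Av\rangle}{\langle Av,Av\rangle}$ and $\Phi(v)=(I-\alpha(v)A)v$. For $v\ne0$ with $\Phi(v)\neq 0$, $\Pi(v)=(I-\alpha(\Phi(v))A)(I-\alpha(v)A)$; $\Pi(v)$ is not defined when $\Phi(v)=0$, so such $v$ are not eigenvectors. A nonzero $u\in\mathbb{R}^n$ with $\Phi(u)\neq0$ is an eigenvector with eigenvalue $\lambda$ if $\Pi(u)u=\lambda u$. "Definite" means positive definite or negative definite; "indefinite" means having both positive and negative eigenvalues. *)

theory Defs
  imports "HOL-Analysis.Analysis"
begin

definition eigenspace :: "real^'n^'n \<Rightarrow> real \<Rightarrow> (real^'n) set" where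
  "eigenspace A k = {v. A *v v = k *\<^sub>R v}"

definition eigenvalues :: "real^'n^'n \<Rightarrow> real set" where
  "eigenvalues A = {k. \<exists>v. v \<noteq> 0 \<and> A *v v = k *\<^sub>R v}"

definition positive_definite :: "real^'n^'n \<Rightarrow> bool" where
  "positive_definite A \<longleftrightarrow> (\<forall>v. v \<noteq> 0 \<longrightarrow> v \<bullet> (A *v v) > 0)"

definition negative_definite :: "real^'n^'n \<Rightarrow> bool" where
  "negative_definite A \<longleftrightarrow> (\<forall>v. v \<noteq> 0 \<longrightarrow> v \<bullet> (A *v v) < 0)"

definition definite :: "real^'n^'n \<Rightarrow> bool" where
  "definite A \<longleftrightarrow> positive_definite A \<or> negative_definite A"

definition indefinite :: "real^'n^'n \<Rightarrow> bool" where
  "indefinite A \<longleftrightarrow> (\<exists>k\<in>eigenvalues A. k > 0) \<and> (\<exists>k\<in>eigenvalues A. k < 0)"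

definition orthonormal_basis :: "nat \<Rightarrow> (nat \<Rightarrow> 'a::real_inner) \<Rightarrow> 'a set \<Rightarrow> bool" where
  "orthonormal_basis m b S \<longleftrightarrow>
     (\<forall>s\<in>{1..m}. \<forall>t\<in>{1..m}. b s \<bullet> b t = (if s = t then 1 else 0)) \<and>
     span (b ` {1..m}) = S"

definition alpha :: "real^'n^'n \<Rightarrow> real^'n \<Rightarrow> real" where
  "alpha A v = (v \<bullet> (A *v v)) / ((A *v v) \<bullet> (A *v v))"

definition Phi :: "real^'n^'n \<Rightarrow> real^'n \<Rightarrow> real^'n" where
  "Phi A v = (mat 1 - alpha A v *\<^sub>R A) *v v"

text \<open>The matrix-valued map below is only meaningful for \<open>v \<noteq> 0\<close> and \<open>Phi A v \<noteq> 0\<close>; being a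
  total function it has a junk value elsewhere, so both conditions are part of the definition of
  an eigenvector.\<close>

definition Pi_mat :: "real^'n^'n \<Rightarrow> real^'n \<Rightarrow> real^'n^'n" where
  "Pi_mat A v = (mat 1 - alpha A (Phi A v) *\<^sub>R A) ** (mat 1 - alpha A v *\<^sub>R A)"

definition nl_eigenvector :: "real^'n^'n \<Rightarrow> real \<Rightarrow> real^'n \<Rightarrow> bool" where
  "nl_eigenvector A \<mu> v \<longleftrightarrow> v \<noteq> 0 \<and> Phi A v \<noteq> 0 \<and> Pi_mat A v *v v = \<mu> *\<^sub>R v"

text \<open>In the following, \<open>u i 1, \<dots>, u i (m i)\<close> is the basis of the \<open>i\<close>-th eigenspace,
  \<open>1 \<le> i \<le> p\<close>.\<close>

definition two_block_vec ::
    "(nat \<Rightarrow> nat) \<Rightarrow> (nat \<Rightarrow> nat \<Rightarrow> real^'n) \<Rightarrow> (nat \<Rightarrow> nat \<Rightarrow> real) \<Rightarrow> nat \<Rightarrow> nat \<Rightarrow> real^'n" where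
  "two_block_vec m u c i j =
     (\<Sum>s=1..m i. c i s *\<^sub>R u i s) + (\<Sum>r=1..m j. c j r *\<^sub>R u j r)"

definition two_block_coeffs ::
    "nat \<Rightarrow> (nat \<Rightarrow> nat) \<Rightarrow> (nat \<Rightarrow> nat \<Rightarrow> real) \<Rightarrow> nat \<Rightarrow> nat \<Rightarrow> bool" where
  "two_block_coeffs p m c i j \<longleftrightarrow>
     i \<in> {1..p} \<and> j \<in> {1..p} \<and> i \<noteq> j \<and>
     (\<exists>s\<in>{1..m i}. c i s \<noteq> 0) \<and> (\<exists>r\<in>{1..m j}. c j r \<noteq> 0)"

definition two_block_vecs :: "nat \<Rightarrow> (nat \<Rightarrow> nat) \<Rightarrow> (nat \<Rightarrow> nat \<Rightarrow> real^'n) \<Rightarrow> (real^'n) set" where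
  "two_block_vecs p m u = {two_block_vec m u c i j | c i j. two_block_coeffs p m c i j}"

end

theory Submission
  imports Defs
begin

text \<open>
  Applying \<open>Pi_mat A v\<close> to \<open>v\<close> is the same as performing two steps of the map \<open>Phi A\<close>. With
  \<open>\<alpha> = alpha A v\<close> and \<open>\<beta> = alpha A (Phi A v)\<close>, the eigenvalue equation is therefore
  the linear relation \<open>(1 - \<mu>) v - (\<alpha> + \<beta>) A v + \<alpha> \<beta> A\<^sup>2 v = 0\<close>: a polynomial of degree at
  most two in \<open>A\<close> kills \<open>v\<close>. As \<open>A\<close> is invertible, \<open>v\<close> cannot be an eigenvector of \<open>A\<close>, since
  such a vector has \<open>Phi A v = 0\<close>. So the polynomial is either zero, which forces \<open>\<mu> = 1\<close> and
  \<open>\<alpha> = 0\<close>, or a genuine quadratic. In the latter case the symmetry of \<open>A\<close> makes its roots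
  real and distinct, and \<open>v\<close> is the sum of two eigenvectors of \<open>A\<close> for these roots
  (lemma \<open>symmetric_quadratic_split\<close>): the plane spanned by \<open>v\<close> and \<open>A v\<close> is invariant under
  \<open>A\<close>, and \<open>A\<close> is diagonalised there.

  Conversely, if \<open>v = x + y\<close> with eigenvectors \<open>x\<close>, \<open>y\<close> for different nonzero eigenvalues \<open>a\<close>,
  \<open>b\<close>, then \<open>Phi A\<close> preserves the plane spanned by \<open>x\<close> and \<open>y\<close>, and in these coordinates two
  steps multiply \<open>v\<close> by
  \<open>(b - a)\<^sup>2 X Y / ((a\<^sup>2 X + b\<^sup>2 Y) (X + Y))\<close> with \<open>X = \<parallel>x\<parallel>\<^sup>2\<close>, \<open>Y = \<parallel>y\<parallel>\<^sup>2\<close>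
  (lemma \<open>Phi_Phi_sum_of_eigenvectors\<close>). This number is positive, and it falls short of one by
  \<open>\<langle>v, A v\<rangle>\<^sup>2 / ((a\<^sup>2 X + b\<^sup>2 Y) (X + Y))\<close>, since \<open>\<langle>v, A v\<rangle> = a X + b Y\<close>. Therefore the eigenvalue
  one belongs exactly to the nonzero vectors with \<open>\<langle>v, A v\<rangle> = 0\<close>, for which \<open>Phi A\<close> does not move \<open>v\<close>
  at all. For definite \<open>A\<close> no nonzero vector is of this kind, and all eigenvalues lie below one.
\<close>

section \<open>Symmetric invertible matrices and the iteration map\<close>

lemma symmetric_inner_commute:
  fixes A :: "real^'n^'n"
  assumes "transpose A = A"
  shows "(A *v x) \<bullet> y = x \<bullet> (A *v y)"
  by (metis assms dot_lmul_matrix transpose_matrix_vector)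

lemma symmetric_eigenvectors_orthogonal:
  fixes A :: "real^'n^'n"
  assumes "transpose A = A" "A *v x = a *\<^sub>R x" "A *v y = b *\<^sub>R y" "a \<noteq> b"
  shows "x \<bullet> y = 0"
  using symmetric_inner_commute[OF assms(1), of x y] assms by simp

lemma invertible_mult_eq_0_iff:
  fixes A :: "real^'n^'n"
  assumes "invertible A"
  shows "A *v x = 0 \<longleftrightarrow> x = 0"
  using assms by (metis invertible_def matrix_left_invertible_ker matrix_vector_mult_0_right)

lemma invertible_eigenvalue_nonzero:
  fixes A :: "real^'n^'n"
  assumes "invertible A" "A *v x = k *\<^sub>R x" "x \<noteq> 0"
  shows "k \<noteq> 0"
proof
  assume "k = 0"
  then have "A *v x = 0"
    using assms(2) by simp
  then show False
    using assms(3) invertible_mult_eq_0_iff[OF assms(1)] by simp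
qed

lemma Phi_altdef: "Phi A v = v - alpha A v *\<^sub>R (A *v v)"
  by (simp add: Phi_def matrix_vector_mult_diff_rdistrib scaleR_matrix_vector_assoc)

lemma Pi_mat_mult_self: "Pi_mat A v *v v = Phi A (Phi A v)"
  by (simp add: Pi_mat_def Phi_def matrix_vector_mul_assoc [symmetric])

lemma nl_eigenvector_iff_Phi_Phi:
  "nl_eigenvector A \<mu> v \<longleftrightarrow> v \<noteq> 0 \<and> Phi A v \<noteq> 0 \<and> Phi A (Phi A v) = \<mu> *\<^sub>R v"
  by (simp add: nl_eigenvector_def Pi_mat_mult_self)

lemma nl_eigenvector_unique:
  assumes "nl_eigenvector A \<mu> v" "nl_eigenvector A \<nu> v"
  shows "\<mu> = \<nu>"
  using assms unfolding nl_eigenvector_def by (metis scaleR_cancel_right)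

section \<open>Linear eigenvectors and isotropic vectors\<close>

text \<open>On an eigenvector the step size is the exact inverse of the eigenvalue, so one step of the
  map already reaches zero.\<close>

lemma Phi_eigenvector_eq_0:
  assumes "A *v v = k *\<^sub>R v" "k \<noteq> 0"
  shows "Phi A v = 0"
  using assms by (simp add: Phi_altdef alpha_def)

lemma alpha_eq_0_iff:
  fixes A :: "real^'n^'n"
  assumes "invertible A"
  shows "alpha A v = 0 \<longleftrightarrow> v \<bullet> (A *v v) = 0"
  by (auto simp: alpha_def invertible_mult_eq_0_iff[OF assms])

text \<open>A step of size zero does not move the vector, hence neither does the second step.\<close>

lemma nl_eigenvector_1_if_alpha_eq_0:
  assumes "v \<noteq> 0" "alpha A v = 0"
  shows "nl_eigenvector A 1 v"
  using assms by (simp add: nl_eigenvector_iff_Phi_Phi Phi_altdef)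

section \<open>Eigenvectors of the nonlinear problem are sums of two linear eigenvectors\<close>

text \<open>After completing the square, the relation \<open>A\<^sup>2 v = s A v + t v\<close> reads \<open>(A - s/2)\<^sup>2 v = d v\<close> with
  \<open>d = s\<^sup>2/4 + t\<close>. Symmetry gives \<open>\<parallel>(A - s/2) v\<parallel>\<^sup>2 = d \<parallel>v\<parallel>\<^sup>2\<close>, so \<open>d \<ge> 0\<close>, and \<open>d = 0\<close> would
  make \<open>v\<close> an eigenvector. With \<open>e = \<surd>d\<close> the vectors \<open>(A - s/2 \<plusminus> e) v\<close> are eigenvectors for
  \<open>s/2 \<plusminus> e\<close>, nonzero since \<open>v\<close> is not an eigenvector, and \<open>2 e v\<close> is their difference.\<close>

lemma symmetric_quadratic_split:
  fixes A :: "real^'n^'n"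
  assumes sym: "transpose A = A"
    and quad: "A *v (A *v v) = s *\<^sub>R (A *v v) + t *\<^sub>R v"
    and not_eigen: "\<And>k. A *v v \<noteq> k *\<^sub>R v"
  obtains a b x y where "a \<noteq> b" "A *v x = a *\<^sub>R x" "A *v y = b *\<^sub>R y" "x \<noteq> 0" "y \<noteq> 0" "v = x + y"
proof -
  define d where "d = s\<^sup>2 / 4 + t"
  define e where "e = sqrt d"
  define w where "w = A *v v - (s/2) *\<^sub>R v"
  have v: "v \<noteq> 0"
    using not_eigen[of 0] by auto
  have w: "w \<noteq> 0"
    using not_eigen[of "s/2"] by (simp add: w_def)
  have Av: "A *v v = w + (s/2) *\<^sub>R v"
    by (simp add: w_def)
  have Aw: "A *v w = d *\<^sub>R v + (s/2) *\<^sub>R w"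
  proof -
    have "s *\<^sub>R (A *v v) = (s/2) *\<^sub>R (A *v v) + (s/2) *\<^sub>R (A *v v)"
      by (simp flip: scaleR_add_left)
    then have "A *v w = (s/2) *\<^sub>R (A *v v) + t *\<^sub>R v"
      by (simp add: w_def matrix_vector_mult_diff_distrib matrix_vector_mult_scaleR quad)
    then show ?thesis
      by (simp add: Av d_def algebra_simps power2_eq_square)
  qed
  have "w \<bullet> w = d * (v \<bullet> v)"
  proof -
    have "w \<bullet> (A *v v) = (A *v w) \<bullet> v"
      by (simp add: symmetric_inner_commute[OF sym])
    then show ?thesis
      by (simp add: Av Aw inner_simps inner_commute)
  qed
  then have "d > 0"
    using v w by (metis inner_gt_zero_iff zero_less_mult_pos2)
  then have e: "e > 0" "e * e = d"
    by (simp_all add: e_def)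
  define x where "x = (1 / (2*e)) *\<^sub>R (w + e *\<^sub>R v)"
  define y where "y = (1 / (2*e)) *\<^sub>R (e *\<^sub>R v - w)"
  show ?thesis
  proof
    show "s/2 + e \<noteq> s/2 - e"
      using e by simp
    have "A *v (w + e *\<^sub>R v) = (s/2 + e) *\<^sub>R (w + e *\<^sub>R v)"
      by (simp add: matrix_vector_mult_scaleR matrix_vector_right_distrib Av Aw e(2)[symmetric]
          algebra_simps)
    then show "A *v x = (s/2 + e) *\<^sub>R x"
      by (simp add: x_def matrix_vector_mult_scaleR)
    have "A *v (e *\<^sub>R v - w) = (s/2 - e) *\<^sub>R (e *\<^sub>R v - w)"
      by (simp add: matrix_vector_mult_scaleR matrix_vector_mult_diff_distrib Av Aw e(2)[symmetric]
          algebra_simps)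
    then show "A *v y = (s/2 - e) *\<^sub>R y"
      by (simp add: y_def matrix_vector_mult_scaleR)
    \<comment> \<open>If \<open>x\<close> or \<open>y\<close> vanished, \<open>v\<close> would itself be an eigenvector for the other root.\<close>
    show "x \<noteq> 0"
    proof
      assume "x = 0"
      then have "w + e *\<^sub>R v = 0"
        using e by (simp add: x_def)
      then have "w = - (e *\<^sub>R v)"
        by (simp add: eq_neg_iff_add_eq_0)
      then have "A *v v = (s/2 - e) *\<^sub>R v"
        by (simp add: Av algebra_simps)
      then show False
        using not_eigen by blast
    qed
    show "y \<noteq> 0"
    proof
      assume "y = 0"
      then have "e *\<^sub>R v - w = 0"
        using e by (simp only: y_def scaleR_eq_0_iff) simp
      then have "A *v v = (s/2 + e) *\<^sub>R v"
        by (simp add: Av algebra_simps)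
      then show False
        using not_eigen by blast
    qed
    have "x + y = (1 / (2*e)) *\<^sub>R ((2*e) *\<^sub>R v)"
      unfolding x_def y_def scaleR_add_right[symmetric] by (simp flip: scaleR_add_left)
    then show "v = x + y"
      using e by simp
  qed
qed

text \<open>The relation \<open>(1 - \<mu>) v - (\<alpha> + \<beta>) A v + \<alpha> \<beta> A\<^sup>2 v = 0\<close> holds with \<open>\<alpha> \<noteq> 0\<close>. If it had
  degree less than two in \<open>A\<close>, then \<open>\<beta> = 0\<close>, and \<open>v\<close> would be an eigenvector of \<open>A\<close>. Its
  eigenvalue would be nonzero as \<open>A\<close> is invertible, so \<open>Phi A v\<close> would vanish.\<close>

lemma nl_eigenvector_split:
  fixes A :: "real^'n^'n"
  assumes inv: "invertible A" and sym: "transpose A = A"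
    and nl: "nl_eigenvector A \<mu> v" and alpha: "alpha A v \<noteq> 0"
  obtains a b x y where "a \<noteq> b" "A *v x = a *\<^sub>R x" "A *v y = b *\<^sub>R y" "x \<noteq> 0" "y \<noteq> 0" "v = x + y"
proof -
  define \<alpha> where "\<alpha> = alpha A v"
  define \<beta> where "\<beta> = alpha A (Phi A v)"
  have v: "v \<noteq> 0" "Phi A v \<noteq> 0" "Phi A (Phi A v) = \<mu> *\<^sub>R v"
    using nl by (auto simp: nl_eigenvector_iff_Phi_Phi)
  have not_eigen: "A *v v \<noteq> k *\<^sub>R v" for k
  proof
    assume k: "A *v v = k *\<^sub>R v"
    then have "k \<noteq> 0"
      using invertible_eigenvalue_nonzero[OF inv] v(1) by blast
    with k v(2) show False
      using Phi_eigenvector_eq_0 by blast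
  qed
  have "Phi A (Phi A v) = v - \<alpha> *\<^sub>R (A *v v) - \<beta> *\<^sub>R (A *v (v - \<alpha> *\<^sub>R (A *v v)))"
    by (simp add: Phi_altdef[of A "Phi A v"] \<beta>_def) (simp add: Phi_altdef \<alpha>_def)
  then have rel: "(\<alpha> * \<beta>) *\<^sub>R (A *v (A *v v)) = (\<alpha> + \<beta>) *\<^sub>R (A *v v) + (\<mu> - 1) *\<^sub>R v"
    by (simp add: v(3) matrix_vector_mult_diff_distrib matrix_vector_mult_scaleR algebra_simps)
  have "\<beta> \<noteq> 0"
  proof
    assume "\<beta> = 0"
    with rel have "\<alpha> *\<^sub>R (A *v v) = (1 - \<mu>) *\<^sub>R v"
      by (simp add: algebra_simps eq_neg_iff_add_eq_0)
    then have "(1 / \<alpha>) *\<^sub>R (\<alpha> *\<^sub>R (A *v v)) = (1 / \<alpha>) *\<^sub>R ((1 - \<mu>) *\<^sub>R v)"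
      by simp
    then have "A *v v = ((1 - \<mu>) / \<alpha>) *\<^sub>R v"
      using alpha by (simp add: \<alpha>_def)
    then show False
      using not_eigen by blast
  qed
  then have "A *v (A *v v) = (1 / (\<alpha> * \<beta>)) *\<^sub>R ((\<alpha> * \<beta>) *\<^sub>R (A *v (A *v v)))"
    using alpha by (simp add: \<alpha>_def)
  also have "\<dots> = ((\<alpha> + \<beta>) / (\<alpha> * \<beta>)) *\<^sub>R (A *v v) + ((\<mu> - 1) / (\<alpha> * \<beta>)) *\<^sub>R v"
    unfolding rel by (simp add: scaleR_add_right)
  finally show ?thesis
    using symmetric_quadratic_split[OF sym _ not_eigen] that by blast
qed

section \<open>The two-step map on a sum of two eigenvectors\<close>

text \<open>The map \<open>Phi A\<close> in the coordinates of the plane spanned by two orthogonal eigenvectors. The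
  numerators come from \<open>1 - \<alpha> a = b (b - a) q\<^sup>2 Y / D\<close> and \<open>1 - \<alpha> b = a (a - b) p\<^sup>2 X / D\<close>, where
  \<open>D = a\<^sup>2 p\<^sup>2 X + b\<^sup>2 q\<^sup>2 Y\<close> is the denominator of \<open>\<alpha>\<close>.\<close>

lemma Phi_sum_of_eigenvectors:
  fixes A :: "real^'n^'n"
  assumes "A *v x = a *\<^sub>R x" "A *v y = b *\<^sub>R y" "x \<bullet> y = 0"
  defines "X \<equiv> x \<bullet> x" and "Y \<equiv> y \<bullet> y"
  assumes D: "a\<^sup>2 * p\<^sup>2 * X + b\<^sup>2 * q\<^sup>2 * Y \<noteq> 0"
  shows "Phi A (p *\<^sub>R x + q *\<^sub>R y) =
    ((b - a) * p * q / (a\<^sup>2 * p\<^sup>2 * X + b\<^sup>2 * q\<^sup>2 * Y)) *\<^sub>R ((b * q * Y) *\<^sub>R x - (a * p * X) *\<^sub>R y)"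
proof -
  let ?D = "a\<^sup>2 * p\<^sup>2 * X + b\<^sup>2 * q\<^sup>2 * Y"
  let ?z = "p *\<^sub>R x + q *\<^sub>R y"
  have Az: "A *v ?z = (p * a) *\<^sub>R x + (q * b) *\<^sub>R y"
    by (simp add: matrix_vector_right_distrib matrix_vector_mult_scaleR assms)
  have yx: "y \<bullet> x = 0"
    using assms(3) by (simp add: inner_commute)
  have al: "alpha A ?z = (a * p\<^sup>2 * X + b * q\<^sup>2 * Y) / ?D"
    unfolding alpha_def Az
    by (simp add: inner_simps assms(3) yx X_def Y_def power2_eq_square algebra_simps)
  have 1: "p - alpha A ?z * (p * a) = (b - a) * p * q / ?D * (b * q * Y)"
    and 2: "q - alpha A ?z * (q * b) = - ((b - a) * p * q / ?D * (a * p * X))"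
    unfolding al using D by (simp_all add: field_simps power2_eq_square)
  have "Phi A ?z = (p - alpha A ?z * (p * a)) *\<^sub>R x + (q - alpha A ?z * (q * b)) *\<^sub>R y"
    unfolding Phi_altdef Az by (simp add: algebra_simps)
  then show ?thesis
    unfolding 1 2 by (simp add: scaleR_diff_right)
qed

text \<open>One step sends \<open>x + y\<close> to a multiple of \<open>b Y x - a X y\<close>, and a second step sends that vector
  back to a multiple of \<open>x + y\<close>.\<close>

lemma Phi_Phi_sum_of_eigenvectors:
  fixes A :: "real^'n^'n"
  assumes sym: "transpose A = A"
    and x: "A *v x = a *\<^sub>R x" "x \<noteq> 0" and y: "A *v y = b *\<^sub>R y" "y \<noteq> 0"
    and ab: "a \<noteq> b" "a \<noteq> 0" "b \<noteq> 0"
  defines "X \<equiv> x \<bullet> x" and "Y \<equiv> y \<bullet> y"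
  shows "nl_eigenvector A ((b - a)\<^sup>2 * X * Y / ((a\<^sup>2 * X + b\<^sup>2 * Y) * (X + Y))) (x + y)"
proof -
  have xy: "x \<bullet> y = 0"
    using symmetric_eigenvectors_orthogonal[OF sym x(1) y(1) ab(1)] .
  have XY: "X > 0" "Y > 0"
    using x y by (simp_all add: X_def Y_def)
  define D where "D = a\<^sup>2 * X + b\<^sup>2 * Y"
  have D: "D > 0"
    unfolding D_def using XY ab by (simp add: add_pos_pos)
  define \<kappa> where "\<kappa> = (b - a) / D"
  have \<kappa>: "\<kappa> \<noteq> 0"
    using D ab by (simp add: \<kappa>_def)
  have step1: "Phi A (x + y) = (\<kappa> * b * Y) *\<^sub>R x + (- (\<kappa> * a * X)) *\<^sub>R y"
    using Phi_sum_of_eigenvectors[OF x(1) y(1) xy, of 1 1] D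
    by (simp add: \<kappa>_def D_def X_def Y_def scaleR_diff_right mult.assoc)
  have D': "a\<^sup>2 * (\<kappa> * b * Y)\<^sup>2 * X + b\<^sup>2 * (- (\<kappa> * a * X))\<^sup>2 * Y = (\<kappa> * a * b)\<^sup>2 * X * Y * (X + Y)"
    by (simp add: power2_eq_square algebra_simps)
  have D'_nz: "(\<kappa> * a * b)\<^sup>2 * X * Y * (X + Y) \<noteq> 0"
    using XY \<kappa> ab by simp
  define \<gamma> where "\<gamma> = (b - a) * (\<kappa> * b * Y) * (- (\<kappa> * a * X)) / ((\<kappa> * a * b)\<^sup>2 * X * Y * (X + Y))"
  have coeff: "\<gamma> * (- (\<kappa> * a * b * X * Y)) = (b - a)\<^sup>2 * X * Y / (D * (X + Y))"
  proof -
    have "X + Y > 0"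
      using XY by simp
    then have "\<gamma> * (- (\<kappa> * a * b * X * Y)) = (b - a) * \<kappa> * X * Y / (X + Y)"
      unfolding \<gamma>_def using XY \<kappa> ab by (simp add: divide_simps power2_eq_square)
    then show ?thesis
      by (simp add: \<kappa>_def power2_eq_square)
  qed
  have "Phi A (Phi A (x + y)) =
      \<gamma> *\<^sub>R ((b * (- (\<kappa> * a * X)) * Y) *\<^sub>R x - (a * (\<kappa> * b * Y) * X) *\<^sub>R y)"
    unfolding step1 \<gamma>_def D'[symmetric]
    unfolding X_def Y_def
    by (rule Phi_sum_of_eigenvectors[OF x(1) y(1) xy])
      (use D' D'_nz in \<open>simp add: X_def Y_def\<close>)
  also have "\<dots> = \<gamma> *\<^sub>R ((- (\<kappa> * a * b * X * Y)) *\<^sub>R (x + y))"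
    by (simp add: algebra_simps)
  also have "\<dots> = ((b - a)\<^sup>2 * X * Y / (D * (X + Y))) *\<^sub>R (x + y)"
    by (simp only: scaleR_scaleR coeff)
  finally have step2: "Phi A (Phi A (x + y)) = ((b - a)\<^sup>2 * X * Y / (D * (X + Y))) *\<^sub>R (x + y)" .
  \<comment> \<open>A vector with a nonzero \<open>x\<close>-component is nonzero.\<close>
  have "(x + y) \<bullet> x \<noteq> 0"
    using XY xy by (simp add: inner_simps inner_commute X_def)
  then have "x + y \<noteq> 0"
    by auto
  moreover have "Phi A (x + y) \<bullet> x \<noteq> 0"
    using XY xy \<kappa> ab by (simp add: step1 inner_simps inner_commute[of y x] X_def[symmetric])
  then have "Phi A (x + y) \<noteq> 0"
    by auto
  ultimately show ?thesis
    using step2 by (simp add: nl_eigenvector_iff_Phi_Phi D_def)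
qed

text \<open>For \<open>v = x + y\<close> the numerator on the right is \<open>\<langle>v, A v\<rangle>\<^sup>2\<close>. Hence the two-step factor never
  exceeds one, and it equals one only if \<open>\<langle>v, A v\<rangle> = 0\<close>.\<close>

lemma two_step_factor_complement:
  fixes a b X Y :: real
  assumes "X > 0" "Y > 0" "a \<noteq> 0" "b \<noteq> 0"
  shows "1 - (b - a)\<^sup>2 * X * Y / ((a\<^sup>2 * X + b\<^sup>2 * Y) * (X + Y)) =
    (a * X + b * Y)\<^sup>2 / ((a\<^sup>2 * X + b\<^sup>2 * Y) * (X + Y))"
proof -
  have "(a\<^sup>2 * X + b\<^sup>2 * Y) * (X + Y) > 0"
    using assms by (intro mult_pos_pos add_pos_pos) simp_all
  moreover have "(a\<^sup>2 * X + b\<^sup>2 * Y) * (X + Y) = (b - a)\<^sup>2 * X * Y + (a * X + b * Y)\<^sup>2"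
    by (simp add: power2_eq_square algebra_simps)
  ultimately show ?thesis
    by (simp add: diff_divide_eq_iff divide_simps)
qed

section \<open>Coordinates in orthonormal bases\<close>

lemma inner_orthonormal_sum:
  assumes "orthonormal_basis m b S" "t \<in> {1..m}"
  shows "(\<Sum>s=1..m. c s *\<^sub>R b s) \<bullet> b t = c t"
proof -
  have "(\<Sum>s=1..m. c s *\<^sub>R b s) \<bullet> b t = (\<Sum>s=1..m. if s = t then c s else 0)"
    unfolding inner_sum_left
    by (rule sum.cong) (use assms in \<open>auto simp: orthonormal_basis_def\<close>)
  also have "\<dots> = c t"
    using assms(2) by simp
  finally show ?thesis .
qed

lemma inner_self_orthonormal_sum:
  assumes "orthonormal_basis m b S"
  shows "(\<Sum>s=1..m. c s *\<^sub>R b s) \<bullet> (\<Sum>s=1..m. c s *\<^sub>R b s) = (\<Sum>s=1..m. (c s)\<^sup>2)"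
proof -
  let ?x = "\<Sum>s=1..m. c s *\<^sub>R b s"
  have "?x \<bullet> ?x = (\<Sum>s=1..m. c s * (?x \<bullet> b s))"
    by (simp only: inner_sum_right[of ?x "\<lambda>s. c s *\<^sub>R b s"] inner_scaleR_right)
  also have "\<dots> = (\<Sum>s=1..m. (c s)\<^sup>2)"
    by (rule sum.cong) (simp_all only: inner_orthonormal_sum[OF assms] power2_eq_square)
  finally show ?thesis .
qed

lemma orthonormal_sum_in_space:
  assumes "orthonormal_basis m b S"
  shows "(\<Sum>s=1..m. c s *\<^sub>R b s) \<in> S"
proof -
  have "(\<Sum>s=1..m. c s *\<^sub>R b s) \<in> span (b ` {1..m})"
    by (intro span_sum span_scale span_base) auto
  then show ?thesis
    using assms by (simp add: orthonormal_basis_def)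
qed

lemma orthonormal_expansion:
  assumes "orthonormal_basis m b S" "x \<in> S"
  shows "x = (\<Sum>s=1..m. (x \<bullet> b s) *\<^sub>R b s)"
proof -
  have "x \<in> span (b ` {1..m})"
    using assms by (simp add: orthonormal_basis_def)
  then show ?thesis
  proof (induction rule: span_induct_alt)
    case base
    then show ?case by simp
  next
    case (step k z y)
    then obtain t where t: "t \<in> {1..m}" "z = b t"
      by blast
    have "(\<Sum>s=1..m. ((k *\<^sub>R z + y) \<bullet> b s) *\<^sub>R b s)
        = k *\<^sub>R (\<Sum>s=1..m. (z \<bullet> b s) *\<^sub>R b s) + (\<Sum>s=1..m. (y \<bullet> b s) *\<^sub>R b s)"
      by (simp add: inner_simps algebra_simps sum.distrib scaleR_sum_right)
    also have "(\<Sum>s=1..m. (z \<bullet> b s) *\<^sub>R b s) = (\<Sum>s=1..m. if s = t then b s else 0)"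
      by (rule sum.cong) (use assms(1) t in \<open>auto simp: orthonormal_basis_def\<close>)
    also have "\<dots> = z"
      using t by simp
    finally show ?case
      using step by simp
  qed
qed

text \<open>The coefficients are the coordinates of \<open>x\<close> and \<open>y\<close> in the bases of their eigenspaces. A
  nonzero vector has a nonzero coordinate, which is what the coefficient condition asks for.\<close>

lemma sum_of_eigenvectors_in_two_block_vecs:
  fixes A :: "real^'n^'n"
  assumes eig: "a ` {1..p} = eigenvalues A"
    and basis: "\<And>i. i \<in> {1..p} \<Longrightarrow> orthonormal_basis (m i) (u i) (eigenspace A (a i))"
    and ka: "k \<noteq> l" and x: "A *v x = k *\<^sub>R x" "x \<noteq> 0" and y: "A *v y = l *\<^sub>R y" "y \<noteq> 0"
  shows "x + y \<in> two_block_vecs p m u"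
proof -
  have "k \<in> a ` {1..p}" "l \<in> a ` {1..p}"
    unfolding eig eigenvalues_def using x y by blast+
  then obtain i j where ij: "i \<in> {1..p}" "k = a i" "j \<in> {1..p}" "l = a j"
    by blast
  then have "i \<noteq> j"
    using ka by auto
  define c where "c = (\<lambda>k s. (if k = i then x else y) \<bullet> u k s)"
  have xs: "x = (\<Sum>s=1..m i. c i s *\<^sub>R u i s)"
    using orthonormal_expansion[OF basis[OF ij(1)], of x] x ij by (simp add: c_def eigenspace_def)
  have ys: "y = (\<Sum>s=1..m j. c j s *\<^sub>R u j s)"
    using orthonormal_expansion[OF basis[OF ij(3)], of y] y ij \<open>i \<noteq> j\<close>
    by (simp add: c_def eigenspace_def)
  have "\<exists>s\<in>{1..m i}. c i s \<noteq> 0"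
    using xs x(2) by (metis (mono_tags, lifting) scaleR_zero_left sum.neutral)
  moreover have "\<exists>s\<in>{1..m j}. c j s \<noteq> 0"
    using ys y(2) by (metis (mono_tags, lifting) scaleR_zero_left sum.neutral)
  ultimately have "two_block_coeffs p m c i j"
    using ij \<open>i \<noteq> j\<close> by (simp add: two_block_coeffs_def)
  moreover have "x + y = two_block_vec m u c i j"
    using xs ys by (simp add: two_block_vec_def)
  ultimately show ?thesis
    unfolding two_block_vecs_def by blast
qed

text \<open>With \<open>X\<close> and \<open>Y\<close> the sums of squared coefficients of the two blocks, these are the squared
  norms of the blocks, and \<open>eps2 = Y / X\<close> turns the two-step factor into the stated eigenvalue.
  It is nonzero because the eigenvalues of the two blocks differ.\<close>

lemma nl_eigenvector_two_block_vec:
  fixes A :: "real^'n^'n"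
  assumes inv: "invertible A" and sym: "transpose A = A"
    and inj: "inj_on a {1..p}" and eig: "a ` {1..p} = eigenvalues A"
    and basis: "\<And>i. i \<in> {1..p} \<Longrightarrow> orthonormal_basis (m i) (u i) (eigenspace A (a i))"
    and coeffs: "two_block_coeffs p m c i j"
  defines "eps2 \<equiv> (\<Sum>r=1..m j. (c j r)\<^sup>2) / (\<Sum>s=1..m i. (c i s)\<^sup>2)"
  defines "lam \<equiv> (a j - a i)\<^sup>2 / ((a i)\<^sup>2 + eps2 * (a j)\<^sup>2) * (1 / (1 + 1 / eps2))"
  shows "nl_eigenvector A lam (two_block_vec m u c i j)" and "lam \<noteq> 0"
proof -
  have ij: "i \<in> {1..p}" "j \<in> {1..p}" "i \<noteq> j"
    using coeffs by (auto simp: two_block_coeffs_def)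
  then have ne: "a i \<noteq> a j"
    using inj by (meson inj_onD)
  have nz: "a l \<noteq> 0" if "l \<in> {1..p}" for l
  proof -
    have "a l \<in> eigenvalues A"
      using that by (simp flip: eig)
    then show ?thesis
      using invertible_eigenvalue_nonzero[OF inv] by (auto simp: eigenvalues_def)
  qed
  define x where "x = (\<Sum>s=1..m i. c i s *\<^sub>R u i s)"
  define y where "y = (\<Sum>s=1..m j. c j s *\<^sub>R u j s)"
  define X where "X = (\<Sum>s=1..m i. (c i s)\<^sup>2)"
  define Y where "Y = (\<Sum>r=1..m j. (c j r)\<^sup>2)"
  obtain s r where sr: "s \<in> {1..m i}" "c i s \<noteq> 0" "r \<in> {1..m j}" "c j r \<noteq> 0"
    using coeffs by (auto simp: two_block_coeffs_def)
  have XY: "X > 0" "Y > 0"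
    unfolding X_def Y_def using sr by (auto intro: sum_pos2[of _ s] sum_pos2[of _ r])
  have xx: "x \<bullet> x = X" and yy: "y \<bullet> y = Y"
    unfolding x_def y_def X_def Y_def using inner_self_orthonormal_sum basis ij by blast+
  have Ax: "A *v x = a i *\<^sub>R x" and Ay: "A *v y = a j *\<^sub>R y"
    using orthonormal_sum_in_space[OF basis] ij by (auto simp: x_def y_def eigenspace_def)
  have "x \<noteq> 0" "y \<noteq> 0"
    using xx yy XY by auto
  then have nl: "nl_eigenvector A
      ((a j - a i)\<^sup>2 * X * Y / (((a i)\<^sup>2 * X + (a j)\<^sup>2 * Y) * (X + Y))) (x + y)"
    using Phi_Phi_sum_of_eigenvectors[OF sym Ax _ Ay _ ne nz nz] ij xx yy by simp
  have D: "(a i)\<^sup>2 * X + (a j)\<^sup>2 * Y > 0"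
    using XY nz ij by (simp add: add_pos_pos)
  have eps2: "eps2 = Y / X"
    by (simp add: eps2_def X_def Y_def)
  have "(a i)\<^sup>2 + eps2 * (a j)\<^sup>2 = ((a i)\<^sup>2 * X + (a j)\<^sup>2 * Y) / X"
    using XY by (simp add: eps2 field_simps)
  moreover have "1 / (1 + 1 / eps2) = Y / (X + Y)"
    using XY by (simp add: eps2 field_simps)
  ultimately have lam:
    "lam = (a j - a i)\<^sup>2 * X * Y / (((a i)\<^sup>2 * X + (a j)\<^sup>2 * Y) * (X + Y))"
    by (simp add: lam_def)
  show "nl_eigenvector A lam (two_block_vec m u c i j)"
    using nl by (simp add: lam two_block_vec_def x_def y_def)
  show "lam \<noteq> 0"
    using lam D XY ne by simp
qed

section \<open>Eigenvalue one and definite matrices\<close>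

text \<open>If \<open>\<langle>v, A v\<rangle>\<close> is nonzero, then \<open>v = x + y\<close> as above, and the eigenvalue misses one by a
  positive multiple of \<open>\<langle>v, A v\<rangle>\<^sup>2\<close>.\<close>

lemma nl_eigenvalue_less_1:
  fixes A :: "real^'n^'n"
  assumes inv: "invertible A" and sym: "transpose A = A"
    and nl: "nl_eigenvector A \<mu> v" and not_isotropic: "v \<bullet> (A *v v) \<noteq> 0"
  shows "\<mu> < 1"
proof -
  have "alpha A v \<noteq> 0"
    using not_isotropic by (simp add: alpha_eq_0_iff[OF inv])
  from nl_eigenvector_split[OF inv sym nl this]
  obtain a b x y where ab: "a \<noteq> b" and Ax: "A *v x = a *\<^sub>R x" and Ay: "A *v y = b *\<^sub>R y"
    and xy: "x \<noteq> 0" "y \<noteq> 0" and v: "v = x + y" .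
  note x = Ax xy(1) and y = Ay xy(2)
  have nz: "a \<noteq> 0" "b \<noteq> 0"
    using invertible_eigenvalue_nonzero[OF inv] x y by blast+
  define X Y where "X = x \<bullet> x" and "Y = y \<bullet> y"
  have XY: "X > 0" "Y > 0"
    using x y by (simp_all add: X_def Y_def)
  have "x \<bullet> y = 0"
    using symmetric_eigenvectors_orthogonal[OF sym x(1) y(1) ab] .
  then have "v \<bullet> (A *v v) = a * X + b * Y"
    by (simp add: v matrix_vector_right_distrib x y inner_simps inner_commute X_def Y_def)
  then have "(a * X + b * Y)\<^sup>2 > 0"
    using not_isotropic by simp
  moreover have "(a\<^sup>2 * X + b\<^sup>2 * Y) * (X + Y) > 0"
    using XY nz by (intro mult_pos_pos add_pos_pos) simp_all
  ultimately have "1 - (b - a)\<^sup>2 * X * Y / ((a\<^sup>2 * X + b\<^sup>2 * Y) * (X + Y)) > 0"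
    unfolding two_step_factor_complement[OF XY nz] by (rule divide_pos_pos)
  moreover have "\<mu> = (b - a)\<^sup>2 * X * Y / ((a\<^sup>2 * X + b\<^sup>2 * Y) * (X + Y))"
    using nl_eigenvector_unique nl Phi_Phi_sum_of_eigenvectors[OF sym x y ab nz]
    unfolding v X_def Y_def by blast
  ultimately show ?thesis
    by simp
qed

lemma nl_eigenvector_1_iff:
  fixes A :: "real^'n^'n"
  assumes inv: "invertible A" and sym: "transpose A = A"
  shows "nl_eigenvector A 1 v \<longleftrightarrow> v \<noteq> 0 \<and> v \<bullet> (A *v v) = 0"
proof
  assume "nl_eigenvector A 1 v"
  then show "v \<noteq> 0 \<and> v \<bullet> (A *v v) = 0"
    using nl_eigenvalue_less_1[OF inv sym, of 1 v] by (auto simp: nl_eigenvector_def)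
next
  assume "v \<noteq> 0 \<and> v \<bullet> (A *v v) = 0"
  then show "nl_eigenvector A 1 v"
    using nl_eigenvector_1_if_alpha_eq_0 alpha_eq_0_iff[OF inv] by blast
qed

lemma definite_not_isotropic:
  assumes "definite A" "v \<noteq> 0"
  shows "v \<bullet> (A *v v) \<noteq> 0"
proof -
  have "v \<bullet> (A *v v) > 0 \<or> v \<bullet> (A *v v) < 0"
    using assms unfolding definite_def positive_definite_def negative_definite_def by blast
  then show ?thesis
    by auto
qed

theorem theorem2p11:
  fixes A :: "real^'n^'n"
    and p :: nat
    and a :: "nat \<Rightarrow> real"
    and m :: "nat \<Rightarrow> nat"
    and u :: "nat \<Rightarrow> nat \<Rightarrow> real^'n"
  assumes "invertible A"
    and "transpose A = A"
    and "inj_on a {1..p}"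
    and "a ` {1..p} = eigenvalues A"
    and "\<And>i. i \<in> {1..p} \<Longrightarrow> orthonormal_basis (m i) (u i) (eigenspace A (a i))"
  shows
    "(definite A \<longrightarrow>
        {v. \<exists>\<mu>. \<mu> \<noteq> 0 \<and> nl_eigenvector A \<mu> v} = two_block_vecs p m u \<and>
        (\<forall>\<mu> v. \<mu> \<noteq> 0 \<and> nl_eigenvector A \<mu> v \<longrightarrow> \<mu> < 1) \<and>
        (\<forall>c i j \<mu>. two_block_coeffs p m c i j \<longrightarrow>
           (let eps2 = (\<Sum>r=1..m j. (c j r)\<^sup>2) / (\<Sum>s=1..m i. (c i s)\<^sup>2)
            in nl_eigenvector A \<mu> (two_block_vec m u c i j) \<longleftrightarrow>
               \<mu> = (a j - a i)\<^sup>2 / ((a i)\<^sup>2 + eps2 * (a j)\<^sup>2) * (1 / (1 + 1 / eps2))))) \<and>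
     (indefinite A \<longrightarrow>
        (\<forall>\<mu> v. \<mu> \<noteq> 1 \<and> nl_eigenvector A \<mu> v \<longrightarrow> v \<in> two_block_vecs p m u) \<and>
        {v. nl_eigenvector A 1 v} = {v. v \<noteq> 0 \<and> (A *v v) \<bullet> v = 0})"
proof -
  note inv = assms(1) and sym = assms(2) and inj = assms(3) and eig = assms(4) and basis = assms(5)
  have in_blocks: "v \<in> two_block_vecs p m u"
    if nl: "nl_eigenvector A \<mu> v" and "v \<bullet> (A *v v) \<noteq> 0" for \<mu> v
  proof -
    have "alpha A v \<noteq> 0"
      using that by (simp add: alpha_eq_0_iff[OF inv])
    from nl_eigenvector_split[OF inv sym nl this]
    obtain k l x y where kl: "k \<noteq> l" "A *v x = k *\<^sub>R x" "A *v y = l *\<^sub>R y" "x \<noteq> 0" "y \<noteq> 0"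
      and v: "v = x + y" .
    show ?thesis
      unfolding v
      by (rule sum_of_eigenvectors_in_two_block_vecs[OF eig basis kl(1,2,4,3,5)])
  qed
  note block = nl_eigenvector_two_block_vec[OF inv sym inj eig basis]
  have not_isotropic: "v \<bullet> (A *v v) \<noteq> 0" if "definite A" "nl_eigenvector A \<mu> v" for \<mu> v
    using that definite_not_isotropic by (auto simp: nl_eigenvector_def)
  show ?thesis
  proof (intro conjI impI)
    assume "definite A"
    show "{v. \<exists>\<mu>. \<mu> \<noteq> 0 \<and> nl_eigenvector A \<mu> v} = two_block_vecs p m u"
    proof
      show "{v. \<exists>\<mu>. \<mu> \<noteq> 0 \<and> nl_eigenvector A \<mu> v} \<subseteq> two_block_vecs p m u"
        using in_blocks not_isotropic[OF \<open>definite A\<close>] by blast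
      show "two_block_vecs p m u \<subseteq> {v. \<exists>\<mu>. \<mu> \<noteq> 0 \<and> nl_eigenvector A \<mu> v}"
        unfolding two_block_vecs_def using block by blast
    qed
    show "\<forall>\<mu> v. \<mu> \<noteq> 0 \<and> nl_eigenvector A \<mu> v \<longrightarrow> \<mu> < 1"
      using nl_eigenvalue_less_1[OF inv sym] not_isotropic[OF \<open>definite A\<close>] by blast
    show "\<forall>c i j \<mu>. two_block_coeffs p m c i j \<longrightarrow>
        (let eps2 = (\<Sum>r=1..m j. (c j r)\<^sup>2) / (\<Sum>s=1..m i. (c i s)\<^sup>2)
         in nl_eigenvector A \<mu> (two_block_vec m u c i j) \<longleftrightarrow>
            \<mu> = (a j - a i)\<^sup>2 / ((a i)\<^sup>2 + eps2 * (a j)\<^sup>2) * (1 / (1 + 1 / eps2)))"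
      unfolding Let_def using block(1) nl_eigenvector_unique by blast
  next
    show "\<forall>\<mu> v. \<mu> \<noteq> 1 \<and> nl_eigenvector A \<mu> v \<longrightarrow> v \<in> two_block_vecs p m u"
    proof (intro allI impI, elim conjE)
      fix \<mu> v
      assume "\<mu> \<noteq> 1" and nl: "nl_eigenvector A \<mu> v"
      then have "\<not> nl_eigenvector A 1 v"
        using nl_eigenvector_unique by blast
      moreover have "v \<noteq> 0"
        using nl by (simp add: nl_eigenvector_def)
      ultimately have "v \<bullet> (A *v v) \<noteq> 0"
        by (simp add: nl_eigenvector_1_iff[OF inv sym])
      then show "v \<in> two_block_vecs p m u"
        using in_blocks nl by blast
    qed
    show "{v. nl_eigenvector A 1 v} = {v. v \<noteq> 0 \<and> (A *v v) \<bullet> v = 0}"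
      by (auto simp: nl_eigenvector_1_iff[OF inv sym] inner_commute)
  qed
qed

end
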